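(* There is a positive constant $C$ such that for all $N\ge2$, $$\int\psi(\xi)\,d\lambda^N(\xi)\le C .$$
   Context: $\mathbb{N}=\{1,2,\dots\}$. Galton-Watson rates: $p$ is a probability distribution on $\mathbb{N}\cup\{0\}$ such that $\sum_{\ell\ge0}p(\ell)e^{\sigma\ell}<\infty$ for some $\sigma>0$ and $\sum_{\ell\ge-1}\ell\,p(\ell+1)<0$ (subcriticality). For $x\ne y$ in $\mathbb{N}\cup\{0\}$: $q(x,y)=x\,p(0)$ if $y=x-1\ge0$, $q(x,y)=x\,p(y-x+1)$ if $y>x\ge1$, and $q(x,y)=0$ otherwise. Fleming-Viot process with $N$ particles ($N\ge2$): the Markov process on $\mathbb{N}^N$ with generator, for bounded $f:\mathbb{N}^N\to\mathbb{R}$, $$\mathcal{L}^Nf(\xi)=\sum_{i=1}^N\sum_{y=1}^\infty\Big[q(\xi(i),y)+q(\xi(i),0)\tfrac{N}{N-1}m(y,\xi)\Big]\,[f(\xi^{i,y})-f(\xi)],\qquad m(x,\xi)=\frac1N\sum_{i=1}^N\mathbf{1}_{\{\xi(i)=x\}},$$ where $\xi^{i,y}(i)=y$ and $\xi^{i,y}(j)=\xi(j)$ for $j\ne i$. Under the assumptions above this process has a unique invariant probability measure, denoted $\lambda^N$. $\psi(\xi):=\dfrac{\sum_{1\le i\le N}\xi^2(i)}{\sum_{1\le i\le N}\xi(i)}$ for $\xi\in\mathbb{N}^N$, where $\xi^2(i)=(\xi(i))^2$. *)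

theory Defs
  imports "HOL-Probability.Probability"
begin

section \<open>Continuous-time Markov chains on a discrete state space\<close>

text \<open>
  The Markov process with a given generator \<open>L\<close> on a countable set \<open>S\<close> is described by its
  transition function, taken to be Feller's minimal one for the Q-matrix of \<open>L\<close> (the minimal
  nonnegative solution of the backward equation).  \<open>ctmc_trans_upto L S n t x y\<close> is the
  probability, starting from \<open>x\<close>, of being in \<open>y\<close> at time \<open>t\<close> after fewer than \<open>n\<close> jumps; the
  recursion decomposes at the time \<open>s\<close> of the first jump.
\<close>

definition q_matrix :: "(('s \<Rightarrow> real) \<Rightarrow> 's \<Rightarrow> real) \<Rightarrow> 's \<Rightarrow> 's \<Rightarrow> real" where
  "q_matrix L x y = L (indicator {y}) x"

primrec ctmc_trans_upto ::
    "(('s \<Rightarrow> real) \<Rightarrow> 's \<Rightarrow> real) \<Rightarrow> 's set \<Rightarrow> nat \<Rightarrow> real \<Rightarrow> 's \<Rightarrow> 's \<Rightarrow> ennreal" where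
  "ctmc_trans_upto L S 0 = (\<lambda>t x y. 0)"
| "ctmc_trans_upto L S (Suc n) = (\<lambda>t x y.
     (if x = y then ennreal (exp (q_matrix L x x * t)) else 0) +
     (\<integral>\<^sup>+s\<in>{0..t}. ennreal (exp (q_matrix L x x * s)) *
        (\<integral>\<^sup>+z. ennreal (q_matrix L x z) * ctmc_trans_upto L S n (t - s) z y
           \<partial>count_space (S - {x})) \<partial>lborel))"

definition ctmc_trans ::
    "(('s \<Rightarrow> real) \<Rightarrow> 's \<Rightarrow> real) \<Rightarrow> 's set \<Rightarrow> real \<Rightarrow> 's \<Rightarrow> 's \<Rightarrow> ennreal" where
  "ctmc_trans L S t x y = (SUP n. ctmc_trans_upto L S n t x y)"

definition invariant_distribution ::
    "(('s \<Rightarrow> real) \<Rightarrow> 's \<Rightarrow> real) \<Rightarrow> 's set \<Rightarrow> 's pmf \<Rightarrow> bool" where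
  "invariant_distribution L S \<mu> \<longleftrightarrow>
     set_pmf \<mu> \<subseteq> S \<and>
     (\<forall>t\<ge>0. \<forall>y\<in>S. (\<integral>\<^sup>+x. ctmc_trans L S t x y \<partial>measure_pmf \<mu>) = ennreal (pmf \<mu> y))"


section \<open>Galton--Watson rates\<close>

definition exp_moment :: "nat pmf \<Rightarrow> bool" where
  "exp_moment p \<longleftrightarrow> (\<exists>\<sigma>>0. summable (\<lambda>l. pmf p l * exp (\<sigma> * real l)))"

text \<open>The summation index is shifted by one: \<open>\<ell> = k - 1\<close> with \<open>k \<ge> 0\<close>.\<close>

definition subcritical :: "nat pmf \<Rightarrow> bool" where
  "subcritical p \<longleftrightarrow> (\<Sum>k. (real k - 1) * pmf p k) < 0"

definition gw_rate :: "nat pmf \<Rightarrow> nat \<Rightarrow> nat \<Rightarrow> real" where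
  "gw_rate p x y =
     (if x \<ge> 1 \<and> y = x - 1 then real x * pmf p 0
      else if y > x \<and> x \<ge> 1 then real x * pmf p (y - x + 1)
      else 0)"


section \<open>The Fleming--Viot particle system\<close>

text \<open>Configurations in \<open>{1, 2, \<dots>}\<^sup>N\<close>; particles are labelled by \<open>{1..N}\<close>.\<close>

definition configs :: "nat \<Rightarrow> (nat \<Rightarrow> nat) set" where
  "configs N = {1..N} \<rightarrow>\<^sub>E {1..}"

definition empirical :: "nat \<Rightarrow> nat \<Rightarrow> (nat \<Rightarrow> nat) \<Rightarrow> real" where
  "empirical N x \<xi> = (\<Sum>i=1..N. of_bool (\<xi> i = x)) / real N"

text \<open>The inner series runs over \<open>y \<ge> 1\<close>, hence the \<open>Suc\<close>.\<close>

definition fv_generator ::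
    "nat pmf \<Rightarrow> nat \<Rightarrow> ((nat \<Rightarrow> nat) \<Rightarrow> real) \<Rightarrow> (nat \<Rightarrow> nat) \<Rightarrow> real" where
  "fv_generator p N f \<xi> =
     (\<Sum>i=1..N. \<Sum>k. let y = Suc k in
        (gw_rate p (\<xi> i) y
           + gw_rate p (\<xi> i) 0 * (real N / (real N - 1)) * empirical N y \<xi>)
        * (f (\<xi>(i := y)) - f \<xi>))"

text \<open>
  Total jump rates are at most linear in \<open>\<Sum>i. \<xi> i\<close>, and so is the generator applied to
  this sum; hence the chain does not explode and the minimal transition function is the only
  one with these rates.
\<close>

definition fv_invariant :: "nat pmf \<Rightarrow> nat \<Rightarrow> (nat \<Rightarrow> nat) pmf \<Rightarrow> bool" where
  "fv_invariant p N \<mu> \<longleftrightarrow> invariant_distribution (fv_generator p N) (configs N) \<mu>"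

definition psi :: "nat \<Rightarrow> (nat \<Rightarrow> nat) \<Rightarrow> real" where
  "psi N \<xi> = (\<Sum>i=1..N. (real (\<xi> i))\<^sup>2) / (\<Sum>i=1..N. real (\<xi> i))"

end

theory Submission
  imports Defs "HOL-Real_Asymp.Real_Asymp"
begin

text \<open>
  The bound is a Foster--Lyapunov argument in which \<open>\<psi>\<close> itself is the Lyapunov function.  Write
  \<open>S = \<Sum>i. \<xi> i\<close>, \<open>Q = \<Sum>i. (\<xi> i)\<^sup>2\<close>, so \<open>\<psi> = Q / S\<close>, and let \<open>l\<close> be the branching increment with law
  \<open>p(l + 1)\<close>, mean \<open>-v < 0\<close> and second moment \<open>b\<close>.  The heart of the matter is
  \<open>L \<psi> \<le> - v \<psi> + 3 b + 2\<close>
  with constants free of \<open>N\<close> (\<open>fv_generator_psi_le\<close>).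

  To first order, a jump that changes \<open>(S, Q)\<close> by \<open>(dS, dQ)\<close> changes \<open>\<psi>\<close> by \<open>(dQ - \<psi> dS) / S\<close>.
  Branching has \<open>L S = - v S\<close> and \<open>L Q = - 2 v Q + b S\<close>, which contributes \<open>- v \<psi> + b\<close>: the
  quadratic sum contracts twice as fast as the linear one.  The selection jumps (a particle that
  would die copies another one) multiply \<open>S\<close> and \<open>Q\<close> by nearly the same factor, so
  they nearly cancel in the ratio.  Beyond first order there are two errors.  For
  branching it is of size \<open>\<psi> b / S\<close>, hence bounded because \<open>\<psi> \<le> S\<close>
  (\<open>branching_increment_le\<close>).  For selection it could be of size \<open>\<psi>\<^sup>2 / S\<close>, and a single
  large particle makes this comparable to \<open>\<psi>\<close>; but by a Chebyshev correlation inequality the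
  error has the favourable sign (\<open>selection_increment_le\<close>, \<open>selection_drift_le\<close>).

  It remains to pass from \<open>L V \<le> v (K - V)\<close> to \<open>\<integral> V \<le> K\<close> for an unbounded \<open>V\<close> and the minimal
  transition function \<open>P\<close>.  Induction on the number of jumps gives
  \<open>P\<^sub>t V \<le> exp (-v t) V + K (1 - exp (-v t))\<close> (\<open>ctmc_trans_upto_lyapunov\<close>).  Integrability of \<open>V\<close> is
  not known beforehand, so invariance is applied to the truncations of \<open>V\<close>, then
  \<open>t \<rightarrow> \<infinity>\<close>, and only then is the truncation removed (\<open>invariant_distribution_lyapunov\<close>).
\<close>

section \<open>Lyapunov functions for the minimal transition function\<close>

lemma borel_measurable_ctmc_trans_upto:
  assumes S: "countable S"
  shows "(\<lambda>t. ctmc_trans_upto L S n t x y) \<in> borel_measurable borel"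
proof (induction n arbitrary: x)
  case 0
  show ?case by simp
next
  case (Suc n)
  interpret C: sigma_finite_measure "count_space (S - {x})"
    using S by (intro sigma_finite_measure_count_space_countable) auto
  have IH[measurable]: "(\<lambda>t. ctmc_trans_upto L S n t z y) \<in> borel_measurable borel" for z
    by (rule Suc.IH)
  have "(\<lambda>(z, u). ennreal (q_matrix L x z) * ctmc_trans_upto L S n (fst u - snd u) z y)
      \<in> borel_measurable (count_space (S - {x}) \<Otimes>\<^sub>M (borel \<Otimes>\<^sub>M borel))"
    using S by (intro measurable_pair_measure_countable1) auto
  then have meas: "(\<lambda>(u, z). ennreal (q_matrix L x z) * ctmc_trans_upto L S n (fst u - snd u) z y)
      \<in> borel_measurable ((borel \<Otimes>\<^sub>M borel) \<Otimes>\<^sub>M count_space (S - {x}))"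
    by (subst measurable_pair_swap_iff) (simp add: case_prod_beta')
  \<comment> \<open>the time argument of the inner integral is split into two coordinates, so that joint
     measurability in \<open>(t, s)\<close> follows from measurability in \<open>t - s\<close> for each state\<close>
  define J where "J r = (\<integral>\<^sup>+z. ennreal (q_matrix L x z) * ctmc_trans_upto L S n (fst r - snd r) z y
           \<partial>count_space (S - {x}))" for r
  have [measurable]: "J \<in> borel_measurable (borel \<Otimes>\<^sub>M borel)"
    using C.borel_measurable_nn_integral[OF meas] unfolding J_def .
  have "(\<lambda>t. \<integral>\<^sup>+s. ennreal (exp (q_matrix L x x * s)) * J (t, s) *
      (if 0 \<le> s \<and> s \<le> t then 1 else 0) \<partial>lborel) \<in> borel_measurable borel"
    by measurable
  moreover have "(if 0 \<le> s \<and> s \<le> t then 1 else 0) = (indicator {0..t} s :: ennreal)" for s t :: real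
    by (auto simp: indicator_def)
  ultimately have "(\<lambda>t. \<integral>\<^sup>+s\<in>{0..t}. ennreal (exp (q_matrix L x x * s)) *
        (\<integral>\<^sup>+z. ennreal (q_matrix L x z) * ctmc_trans_upto L S n (t - s) z y
           \<partial>count_space (S - {x})) \<partial>lborel) \<in> borel_measurable borel"
    by (simp add: J_def)
  then show ?case by simp
qed

lemma incseq_ctmc_trans_upto: "incseq (\<lambda>n. ctmc_trans_upto L S n t x y)"
proof (rule incseq_SucI)
  fix n
  show "ctmc_trans_upto L S n t x y \<le> ctmc_trans_upto L S (Suc n) t x y"
  proof (induction n arbitrary: t x)
    case (Suc n)
    have "ctmc_trans_upto L S (Suc n) t x y \<le> ctmc_trans_upto L S (Suc (Suc n)) t x y"
      unfolding ctmc_trans_upto.simps(2)[of L S n] ctmc_trans_upto.simps(2)[of L S "Suc n"]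
      by (intro add_mono order_refl nn_integral_mono mult_right_mono mult_left_mono
          Suc.IH[unfolded ctmc_trans_upto.simps(2)[of L S n]] zero_le)
    then show ?case .
  qed simp
qed

text \<open>
  The drift condition \<open>L V \<le> v * (K - V)\<close>, with the diagonal rate moved to the right-hand side.
  In this balanced form both sides are sums of nonnegative terms, so it makes sense in
  \<open>ennreal\<close> and includes finiteness of the inflow \<open>\<Sum>z \<noteq> x. q(x, z) V(z)\<close>.  For \<open>V = 1\<close> and \<open>K = 1\<close>
  it says that the off-diagonal rates sum up to at most \<open>- q(x, x)\<close>.
\<close>

definition lyapunov ::
    "(('s \<Rightarrow> real) \<Rightarrow> 's \<Rightarrow> real) \<Rightarrow> 's set \<Rightarrow> real \<Rightarrow> real \<Rightarrow> ('s \<Rightarrow> real) \<Rightarrow> bool" where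
  "lyapunov L S v K V \<longleftrightarrow> (\<forall>x\<in>S. 0 \<le> V x \<and> q_matrix L x x \<le> 0 \<and>
     (\<integral>\<^sup>+z. ennreal (q_matrix L x z) * ennreal (V z) \<partial>count_space (S - {x})) + ennreal (v * V x)
       \<le> ennreal (- q_matrix L x x * V x + v * K))"

text \<open>
  The bound \<open>w t x = exp (-v t) V x + K (1 - exp (-v t))\<close> solves \<open>w' = v (K - w)\<close>, \<open>w 0 = V\<close>, and the
  drift condition makes it a supersolution of the backward equation.  Inserted into the first-jump
  recursion, the integrand is dominated by the derivative in \<open>s\<close> of \<open>- exp (q s) w (t - s) x\<close> with \<open>q = q(x, x)\<close>,
  whose boundary terms are \<open>w t x\<close> and the no-jump contribution \<open>exp (q t) V x\<close>.
\<close>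

lemma ctmc_trans_upto_lyapunov:
  assumes S: "countable S" and v: "v > 0" and K: "K \<ge> 0"
    and V: "lyapunov L S v K V" and one: "lyapunov L S v 1 (\<lambda>_. 1)"
    and "x \<in> S" "t \<ge> 0"
  shows "(\<integral>\<^sup>+y. ctmc_trans_upto L S n t x y * ennreal (V y) \<partial>count_space S)
     \<le> ennreal (exp (- v * t) * V x + K * (1 - exp (- v * t)))"
  using \<open>x \<in> S\<close> \<open>t \<ge> 0\<close>
proof (induction n arbitrary: x t)
  case 0
  show ?case by simp
next
  case (Suc n)
  define q where "q = q_matrix L x x"
  define a where "a s = exp (- v * s)" for s
  define w where "w s z = a s * V z + K * (1 - a s)" for s z
  define g where "g s = exp (q * s) * (a (t - s) * (- q * V x + v * K - v * V x)
      + K * (1 - a (t - s)) * - q)" for s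
  define u where "u = ctmc_trans_upto L S n"
  note [measurable] = borel_measurable_ctmc_trans_upto[OF S, of L n, folded u_def]
  have q: "q \<le> 0" and Vx: "V x \<ge> 0" using V Suc.prems by (auto simp: lyapunov_def q_def)
  have a: "0 \<le> a s" "0 \<le> s \<Longrightarrow> a s \<le> 1" for s using v by (auto simp: a_def)
  have Vpos: "V z \<ge> 0" if "z \<in> S" for z using V that by (auto simp: lyapunov_def)
  have IH: "(\<integral>\<^sup>+y. u s z y * ennreal (V y) \<partial>count_space S) \<le> ennreal (w s z)"
    if "z \<in> S" "s \<ge> 0" for z s using Suc.IH[OF that] by (simp add: w_def a_def u_def)
  let ?in = "\<integral>\<^sup>+z. ennreal (q_matrix L x z) * ennreal (V z) \<partial>count_space (S - {x})"
  let ?in1 = "\<integral>\<^sup>+z. ennreal (q_matrix L x z) \<partial>count_space (S - {x})"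
  have inV: "?in + ennreal (v * V x) \<le> ennreal (- q * V x + v * K)"
    using V Suc.prems by (auto simp: lyapunov_def q_def)
  \<comment> \<open>split the two drift conditions into statements about the inflow alone\<close>
  have nn: "0 \<le> - q * V x + v * K" using mult_nonpos_nonneg[OF q Vx] mult_nonneg_nonneg[of v K] v K by linarith
  have "ennreal (v * V x) \<le> ennreal (- q * V x + v * K)"
    using inV by (rule order_trans[rotated]) simp
  then have nonneg: "0 \<le> - q * V x + v * K - v * V x"
    using nn by (simp add: ennreal_le_iff)
  have "?in \<le> ennreal (- q * V x + v * K) - ennreal (v * V x)"
    using inV by (simp add: ennreal_le_minus_iff add.commute)
  then have inV: "?in \<le> ennreal (- q * V x + v * K - v * V x)"
    using Vx v by (simp add: ennreal_minus)
  have "?in1 + ennreal v \<le> ennreal (- q + v)"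
    using one Suc.prems by (auto simp: lyapunov_def q_def)
  then have "?in1 \<le> ennreal (- q + v) - ennreal v"
    by (simp add: ennreal_le_minus_iff add.commute)
  then have in1: "?in1 \<le> ennreal (- q)"
    using q v by (simp add: ennreal_minus)
  have inner: "(\<integral>\<^sup>+z. ennreal (q_matrix L x z) * ennreal (w s z) \<partial>count_space (S - {x}))
      \<le> ennreal (a s * (- q * V x + v * K - v * V x) + K * (1 - a s) * - q)" if "s \<ge> 0" for s
  proof -
    have w_eq: "ennreal (w s z) = ennreal (a s) * ennreal (V z) + ennreal (K * (1 - a s))" if "z \<in> S" for z
      using a[of s] Vpos[OF that] K \<open>s \<ge> 0\<close> by (simp add: w_def ennreal_mult)
    have "(\<integral>\<^sup>+z. ennreal (q_matrix L x z) * ennreal (w s z) \<partial>count_space (S - {x}))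
      = (\<integral>\<^sup>+z. ennreal (a s) * (ennreal (q_matrix L x z) * ennreal (V z))
          + ennreal (K * (1 - a s)) * ennreal (q_matrix L x z) \<partial>count_space (S - {x}))"
    proof (intro nn_integral_cong)
      fix z assume "z \<in> space (count_space (S - {x}))"
      then have "z \<in> S" by simp
      then show "ennreal (q_matrix L x z) * ennreal (w s z)
          = ennreal (a s) * (ennreal (q_matrix L x z) * ennreal (V z))
            + ennreal (K * (1 - a s)) * ennreal (q_matrix L x z)"
        by (simp only: w_eq distrib_left mult.commute mult.left_commute)
    qed
    also have "\<dots> = ennreal (a s) * ?in + ennreal (K * (1 - a s)) * ?in1"
      by (simp add: nn_integral_add nn_integral_cmult)
    also have "\<dots> \<le> ennreal (a s) * ennreal (- q * V x + v * K - v * V x)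
        + ennreal (K * (1 - a s)) * ennreal (- q)"
      by (intro add_mono mult_left_mono inV in1) auto
    also have "\<dots> = ennreal (a s * (- q * V x + v * K - v * V x) + K * (1 - a s) * - q)"
    proof -
      have split: "ennreal (c1 * d1 + c2 * d2) = ennreal c1 * ennreal d1 + ennreal c2 * ennreal d2"
        if "0 \<le> c1" "0 \<le> d1" "0 \<le> c2" "0 \<le> d2" for c1 d1 c2 d2
        by (simp add: that ennreal_mult)
      have k: "0 \<le> K * (1 - a s)" using a[of s] K \<open>s \<ge> 0\<close> by (intro mult_nonneg_nonneg) auto
      have "0 \<le> - q" using q by simp
      from split[OF a(1)[of s] nonneg k this] show ?thesis by (rule sym)
    qed
    finally show ?thesis .
  qed
  have deriv: "((\<lambda>s. - (exp (q * s) * w (t - s) x)) has_real_derivative g s) (at s)" for s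
    unfolding g_def w_def a_def by (auto intro!: derivative_eq_intros simp: algebra_simps)
  have gpos: "0 \<le> g s" if "0 \<le> s" "s \<le> t" for s
    unfolding g_def using a[of "t - s"] nonneg K q that
    by (intro mult_nonneg_nonneg add_nonneg_nonneg) auto
  \<comment> \<open>needed because \<open>ennreal\<close> truncates the difference of the boundary terms at 0\<close>
  have "- (exp (q * 0) * w (t - 0) x) \<le> - (exp (q * t) * w (t - t) x)"
  proof (rule DERIV_nonneg_imp_nondecreasing[of 0 t])
    show "\<exists>y. ((\<lambda>s. - (exp (q * s) * w (t - s) x)) has_real_derivative y) (at s) \<and> 0 \<le> y"
      if "0 \<le> s" "s \<le> t" for s
      by (rule exI[of _ "g s"]) (intro conjI deriv gpos that)
  qed (rule Suc.prems)
  then have mono: "exp (q * t) * V x \<le> w t x"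
    by (simp add: w_def a_def)
  define I where "I s y = (\<integral>\<^sup>+z. ennreal (q_matrix L x z) * u (t - s) z y \<partial>count_space (S - {x}))" for s y
  interpret C: sigma_finite_measure "count_space (S - {x})"
    using S by (intro sigma_finite_measure_count_space_countable) auto
  interpret CS: sigma_finite_measure "count_space S"
    using S by (intro sigma_finite_measure_count_space_countable) auto
  interpret P: pair_sigma_finite "count_space S" lborel ..
  interpret P2: pair_sigma_finite "count_space S" "count_space (S - {x})" ..
  have I_meas[measurable]: "(\<lambda>s. I s y) \<in> borel_measurable borel" for y
  proof -
    have "(\<lambda>(z, s). ennreal (q_matrix L x z) * u (t - s) z y)
        \<in> borel_measurable (count_space (S - {x}) \<Otimes>\<^sub>M borel)"
      using S by (intro measurable_pair_measure_countable1) auto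
    then have "(\<lambda>(s, z). ennreal (q_matrix L x z) * u (t - s) z y)
        \<in> borel_measurable (borel \<Otimes>\<^sub>M count_space (S - {x}))"
      by (subst measurable_pair_swap_iff) (simp add: case_prod_beta')
    from C.borel_measurable_nn_integral[OF this] show ?thesis by (simp add: I_def)
  qed
  have "(\<integral>\<^sup>+y. (\<integral>\<^sup>+s\<in>{0..t}. ennreal (exp (q * s)) * I s y \<partial>lborel) * ennreal (V y) \<partial>count_space S)
      = (\<integral>\<^sup>+y. (\<integral>\<^sup>+s. ennreal (exp (q * s)) * I s y * indicator {0..t} s * ennreal (V y) \<partial>lborel) \<partial>count_space S)"
    by (subst nn_integral_multc) auto
  also have "\<dots> = (\<integral>\<^sup>+s. (\<integral>\<^sup>+y. ennreal (exp (q * s)) * I s y * indicator {0..t} s * ennreal (V y) \<partial>count_space S) \<partial>lborel)"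
    using S by (intro P.Fubini'[symmetric] measurable_pair_measure_countable1) auto
  also have "\<dots> = (\<integral>\<^sup>+s\<in>{0..t}. ennreal (exp (q * s)) * (\<integral>\<^sup>+y. I s y * ennreal (V y) \<partial>count_space S) \<partial>lborel)"
    by (intro nn_integral_cong) (simp add: nn_integral_cmult[symmetric] nn_integral_multc[symmetric] ac_simps)
  also have "\<dots> \<le> (\<integral>\<^sup>+s\<in>{0..t}. ennreal (g s) \<partial>lborel)"
  proof (intro nn_integral_mono)
    fix s :: real
    have "ennreal (exp (q * s)) * (\<integral>\<^sup>+y. I s y * ennreal (V y) \<partial>count_space S) \<le> ennreal (g s)"
      if s: "s \<in> {0..t}"
    proof -
      have "(\<integral>\<^sup>+y. I s y * ennreal (V y) \<partial>count_space S)
         = (\<integral>\<^sup>+y. (\<integral>\<^sup>+z. ennreal (q_matrix L x z) * (u (t - s) z y * ennreal (V y)) \<partial>count_space (S - {x})) \<partial>count_space S)"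
        by (simp add: I_def nn_integral_multc[symmetric] mult.assoc)
      also have "\<dots> = (\<integral>\<^sup>+z. (\<integral>\<^sup>+y. ennreal (q_matrix L x z) * (u (t - s) z y * ennreal (V y)) \<partial>count_space S) \<partial>count_space (S - {x}))"
        using S by (intro P2.Fubini'[symmetric] measurable_pair_measure_countable1) auto
      also have "\<dots> = (\<integral>\<^sup>+z. ennreal (q_matrix L x z) * (\<integral>\<^sup>+y. u (t - s) z y * ennreal (V y) \<partial>count_space S) \<partial>count_space (S - {x}))"
        by (simp add: nn_integral_cmult)
      also have "\<dots> \<le> (\<integral>\<^sup>+z. ennreal (q_matrix L x z) * ennreal (w (t - s) z) \<partial>count_space (S - {x}))"
        using s by (intro nn_integral_mono mult_left_mono IH) auto
      also have "\<dots> \<le> ennreal (a (t - s) * (- q * V x + v * K - v * V x) + K * (1 - a (t - s)) * - q)"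
        using s by (intro inner) auto
      finally show ?thesis
        unfolding g_def by (subst ennreal_mult') (auto intro!: mult_left_mono)
    qed
    then show "ennreal (exp (q * s)) * (\<integral>\<^sup>+y. I s y * ennreal (V y) \<partial>count_space S) * indicator {0..t} s
        \<le> ennreal (g s) * indicator {0..t} s"
      by (auto simp: indicator_def)
  qed
  also have "\<dots> = ennreal (- (exp (q * t) * w (t - t) x) - (- (exp (q * 0) * w (t - 0) x)))"
  proof (rule nn_integral_FTC_Icc[where F="\<lambda>s. - (exp (q * s) * w (t - s) x)"])
    show "g \<in> borel_measurable borel" unfolding g_def a_def by measurable
    show "((\<lambda>s. - (exp (q * s) * w (t - s) x)) has_real_derivative g s) (at s)" for s by (rule deriv)
    show "0 \<le> g s" if "s \<in> {0..t}" for s using that by (intro gpos) auto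
  qed (use Suc.prems in auto)
  also have "\<dots> = ennreal (w t x - exp (q * t) * V x)"
    by (simp add: w_def a_def algebra_simps)
  finally have second: "(\<integral>\<^sup>+y. (\<integral>\<^sup>+s\<in>{0..t}. ennreal (exp (q * s)) * I s y \<partial>lborel) * ennreal (V y) \<partial>count_space S)
      \<le> ennreal (w t x - exp (q * t) * V x)" .
  have first: "(\<integral>\<^sup>+y. (if x = y then ennreal (exp (q * t)) else 0) * ennreal (V y) \<partial>count_space S)
      = ennreal (exp (q * t) * V x)"
  proof -
    have "(\<integral>\<^sup>+y. (if x = y then ennreal (exp (q * t)) else 0) * ennreal (V y) \<partial>count_space S)
      = (\<integral>\<^sup>+y. ennreal (exp (q * t) * V x) * indicator {x} y \<partial>count_space S)"
      by (intro nn_integral_cong) (auto simp: ennreal_mult' indicator_def)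
    also have "\<dots> = ennreal (exp (q * t) * V x)"
      using Suc.prems by (subst nn_integral_cmult_indicator) (auto simp: one_ennreal_def[symmetric])
    finally show ?thesis .
  qed
  have "(\<integral>\<^sup>+y. ctmc_trans_upto L S (Suc n) t x y * ennreal (V y) \<partial>count_space S)
     = (\<integral>\<^sup>+y. (if x = y then ennreal (exp (q * t)) else 0) * ennreal (V y)
          + (\<integral>\<^sup>+s\<in>{0..t}. ennreal (exp (q * s)) * I s y \<partial>lborel) * ennreal (V y) \<partial>count_space S)"
    unfolding ctmc_trans_upto.simps(2) distrib_right q_def I_def u_def ..
  also have "\<dots> \<le> ennreal (exp (q * t) * V x) + ennreal (w t x - exp (q * t) * V x)"
    by (subst nn_integral_add) (auto simp: first intro!: add_left_mono second)
  also have "\<dots> = ennreal (w t x)"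
    using mono Vx by (simp flip: ennreal_plus)
  finally show ?case by (simp add: w_def a_def)
qed


lemma ctmc_trans_lyapunov:
  assumes S: "countable S" and "v > 0" and "K \<ge> 0"
    and "lyapunov L S v K V" and "lyapunov L S v 1 (\<lambda>_. 1)"
    and "x \<in> S" "t \<ge> 0"
  shows "(\<integral>\<^sup>+y. ctmc_trans L S t x y * ennreal (V y) \<partial>count_space S)
     \<le> ennreal (exp (- v * t) * V x + K * (1 - exp (- v * t)))"
proof -
  have "(\<integral>\<^sup>+y. ctmc_trans L S t x y * ennreal (V y) \<partial>count_space S)
      = (\<integral>\<^sup>+y. (SUP n. ctmc_trans_upto L S n t x y * ennreal (V y)) \<partial>count_space S)"
    by (simp add: ctmc_trans_def SUP_mult_right_ennreal)
  also have "\<dots> = (SUP n. \<integral>\<^sup>+y. ctmc_trans_upto L S n t x y * ennreal (V y) \<partial>count_space S)"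
    using incseq_ctmc_trans_upto[of L S t x]
    by (intro nn_integral_monotone_convergence_SUP)
      (auto simp: incseq_def le_fun_def intro!: mult_right_mono)
  also have "\<dots> \<le> ennreal (exp (- v * t) * V x + K * (1 - exp (- v * t)))"
    by (intro SUP_least ctmc_trans_upto_lyapunov assms)
  finally show ?thesis .
qed

text \<open>
  For bounded truncations \<open>min V M\<close>, invariance gives
  \<open>\<integral> min V M \<le> \<integral> min (exp (-v t) V + K (1 - exp (-v t))) M\<close>.  The right-hand side
  tends to \<open>min K M\<close> as \<open>t \<rightarrow> \<infinity>\<close> by dominated convergence, whether or not \<open>V\<close> is
  integrable.  The second hypothesis, for the constant 1, makes the transition function
  sub-Markovian, which keeps \<open>P\<^sub>t (min V M)\<close> below \<open>M\<close>.
\<close>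

lemma invariant_distribution_lyapunov:
  assumes S: "countable S" and v: "v > 0" and K: "K \<ge> 0"
    and V: "lyapunov L S v K V" and one: "lyapunov L S v 1 (\<lambda>_. 1)"
    and inv: "invariant_distribution L S \<mu>"
  shows "(\<integral>\<^sup>+x. ennreal (V x) \<partial>measure_pmf \<mu>) \<le> ennreal K"
proof -
  have \<mu>S: "set_pmf \<mu> \<subseteq> S" and inv: "\<And>t y. t \<ge> 0 \<Longrightarrow> y \<in> S \<Longrightarrow>
      (\<integral>\<^sup>+x. ctmc_trans L S t x y \<partial>measure_pmf \<mu>) = ennreal (pmf \<mu> y)"
    using inv by (auto simp: invariant_distribution_def)
  have Vpos: "V x \<ge> 0" if "x \<in> S" for x using V that by (auto simp: lyapunov_def)
  interpret CS: sigma_finite_measure "count_space S"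
    using S by (intro sigma_finite_measure_count_space_countable) auto
  interpret P: pair_sigma_finite "count_space S" "measure_pmf \<mu>" ..
  have stationary: "(\<integral>\<^sup>+x. f x \<partial>measure_pmf \<mu>)
      = (\<integral>\<^sup>+x. (\<integral>\<^sup>+y. ctmc_trans L S t x y * f y \<partial>count_space S) \<partial>measure_pmf \<mu>)"
    if "t \<ge> 0" for f :: "'a \<Rightarrow> ennreal" and t
  proof -
    have "(\<integral>\<^sup>+x. f x \<partial>measure_pmf \<mu>) = (\<integral>\<^sup>+y. ennreal (pmf \<mu> y) * f y \<partial>count_space UNIV)"
      by (simp add: nn_integral_measure_pmf)
    also have "\<dots> = (\<integral>\<^sup>+y. ennreal (pmf \<mu> y) * f y \<partial>count_space S)"
      using \<mu>S by (intro nn_integral_count_space_eq) (auto simp: set_pmf_iff)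
    also have "\<dots> = (\<integral>\<^sup>+y. (\<integral>\<^sup>+x. ctmc_trans L S t x y * f y \<partial>measure_pmf \<mu>) \<partial>count_space S)"
      by (intro nn_integral_cong) (simp add: inv that nn_integral_multc)
    also have "\<dots> = (\<integral>\<^sup>+x. (\<integral>\<^sup>+y. ctmc_trans L S t x y * f y \<partial>count_space S) \<partial>measure_pmf \<mu>)"
      using S by (intro P.Fubini'[symmetric] measurable_pair_measure_countable1) auto
    finally show ?thesis .
  qed
  have le: "(\<integral>\<^sup>+x. ennreal (min (V x) M) \<partial>measure_pmf \<mu>)
      \<le> (\<integral>\<^sup>+x. ennreal (min (exp (- v * t) * V x + K * (1 - exp (- v * t))) M) \<partial>measure_pmf \<mu>)"
    if "M \<ge> 0" "t \<ge> 0" for M t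
    unfolding stationary[OF \<open>t \<ge> 0\<close>, of "\<lambda>x. ennreal (min (V x) M)"]
  proof (intro nn_integral_mono_AE AE_pmfI)
    fix x assume "x \<in> set_pmf \<mu>"
    then have x: "x \<in> S" using \<mu>S by auto
    have "(\<integral>\<^sup>+y. ctmc_trans L S t x y * ennreal (min (V y) M) \<partial>count_space S)
       \<le> (\<integral>\<^sup>+y. ctmc_trans L S t x y * ennreal (V y) \<partial>count_space S)"
      by (intro nn_integral_mono mult_left_mono ennreal_leI) auto
    also have "\<dots> \<le> ennreal (exp (- v * t) * V x + K * (1 - exp (- v * t)))"
      by (intro ctmc_trans_lyapunov S v K V one x that)
    finally have 1: "(\<integral>\<^sup>+y. ctmc_trans L S t x y * ennreal (min (V y) M) \<partial>count_space S)
       \<le> ennreal (exp (- v * t) * V x + K * (1 - exp (- v * t)))" .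
    have "(\<integral>\<^sup>+y. ctmc_trans L S t x y * ennreal (min (V y) M) \<partial>count_space S)
       \<le> (\<integral>\<^sup>+y. ennreal M * (ctmc_trans L S t x y * ennreal 1) \<partial>count_space S)"
      by (intro nn_integral_mono) (auto simp: mult.commute intro!: mult_left_mono mult_right_mono ennreal_leI)
    also have "\<dots> = ennreal M * (\<integral>\<^sup>+y. ctmc_trans L S t x y * ennreal 1 \<partial>count_space S)"
      by (rule nn_integral_cmult) auto
    also have "\<dots> \<le> ennreal M * ennreal (exp (- v * t) * 1 + 1 * (1 - exp (- v * t)))"
      by (intro mult_left_mono ctmc_trans_lyapunov[where V="\<lambda>_. 1"] S v one x that) auto
    finally show "(\<integral>\<^sup>+y. ctmc_trans L S t x y * ennreal (min (V y) M) \<partial>count_space S)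
       \<le> ennreal (min (exp (- v * t) * V x + K * (1 - exp (- v * t))) M)"
      using 1 by (simp add: min_def)
  qed
  have trunc: "(\<integral>\<^sup>+x. ennreal (min (V x) M) \<partial>measure_pmf \<mu>) \<le> ennreal K" if M: "M \<ge> 0" for M
  proof -
    have exp0: "(\<lambda>n. exp (- v * real n)) \<longlonglongrightarrow> 0"
      using v by real_asymp
    have lim: "(\<lambda>n. ennreal (min (exp (- v * real n) * V x + K * (1 - exp (- v * real n))) M))
       \<longlonglongrightarrow> ennreal (min (0 * V x + K * (1 - 0)) M)" for x
      by (intro tendsto_ennrealI tendsto_min tendsto_add tendsto_mult tendsto_diff tendsto_const exp0)
    have "(\<lambda>n. \<integral>\<^sup>+x. ennreal (min (exp (- v * real n) * V x + K * (1 - exp (- v * real n))) M) \<partial>measure_pmf \<mu>)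
       \<longlonglongrightarrow> (\<integral>\<^sup>+x. ennreal (min (0 * V x + K * (1 - 0)) M) \<partial>measure_pmf \<mu>)"
      by (rule nn_integral_dominated_convergence[where w="\<lambda>_. ennreal M", OF _ _ _ _ _ AE_I2[OF lim]])
        (auto intro!: ennreal_leI simp: measure_pmf.emeasure_space_1)
    then have "(\<integral>\<^sup>+x. ennreal (min (V x) M) \<partial>measure_pmf \<mu>)
       \<le> (\<integral>\<^sup>+x. ennreal (min (0 * V x + K * (1 - 0)) M) \<partial>measure_pmf \<mu>)"
      by (rule LIMSEQ_le_const) (use le[OF M] in auto)
    also have "\<dots> \<le> ennreal K"
      by (simp add: measure_pmf.emeasure_space_1 ennreal_leI)
    finally show ?thesis .
  qed
  have "(\<lambda>n. \<integral>\<^sup>+x. ennreal (min (V x) (real n)) \<partial>measure_pmf \<mu>) \<longlonglongrightarrow> (\<integral>\<^sup>+x. ennreal (V x) \<partial>measure_pmf \<mu>)"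
  proof (rule nn_integral_LIMSEQ)
    show "(\<lambda>n. ennreal (min (V x) (real n))) \<longlonglongrightarrow> ennreal (V x)" for x
    proof (rule tendsto_eventually)
      have "V x \<le> real n" if "n \<ge> nat \<lceil>V x\<rceil>" for n using that by linarith
      then show "\<forall>\<^sub>F n in sequentially. ennreal (min (V x) (real n)) = ennreal (V x)"
        by (intro eventually_sequentiallyI[of "nat \<lceil>V x\<rceil>"]) (simp add: min_absorb1)
    qed
  qed (auto simp: incseq_def le_fun_def intro!: ennreal_leI)
  then show ?thesis
    by (rule LIMSEQ_le_const2) (auto intro!: trunc)
qed

section \<open>Jump rates of the Fleming--Viot process\<close>

lemma gw_rate_nonneg: "gw_rate p x y \<ge> 0"
  by (simp add: gw_rate_def)

text \<open>
  A branching particle at \<open>x\<close> moves by \<open>k - 1\<close> with rate \<open>x p(k)\<close>.  The term \<open>k = 1\<close> is no jump at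
  all, which \<open>F x = 0\<close> neutralises, and the jump to 0, present only for \<open>x = 1\<close>, is not
  part of a sum over positive states and is subtracted.
\<close>

lemma gw_rate_sums:
  fixes F :: "nat \<Rightarrow> real"
  assumes x: "x \<ge> 1" and F: "F x = 0" and sm: "summable (\<lambda>k. pmf p k * F (x + k - 1))"
  shows "(\<lambda>k. gw_rate p x (Suc k) * F (Suc k)) sums
           (real x * (\<Sum>k. pmf p k * F (x + k - 1)) - gw_rate p x 0 * F 0)"
proof -
  obtain x' where x': "x = Suc x'" using x by (cases x) auto
  define f where "f y = gw_rate p x y * F y" for y
  have f: "f (k + x') = real x * (pmf p k * F (x + k - 1))" for k
    using F unfolding f_def gw_rate_def x'
    by (cases k) (auto simp: add.commute le_add_diff_inverse)
  have f0: "f k = 0" if "k < x'" for k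
    using that by (auto simp: f_def gw_rate_def x')
  have "(\<lambda>k. f (k + x')) sums (real x * (\<Sum>k. pmf p k * F (x + k - 1)))"
    unfolding f by (intro sums_mult summable_sums sm)
  then have "f sums (real x * (\<Sum>k. pmf p k * F (x + k - 1)) + (\<Sum>i<x'. f i))"
    by (rule sums_iff_shift[THEN iffD1])
  then have "f sums (real x * (\<Sum>k. pmf p k * F (x + k - 1)))"
    by (simp add: f0)
  then have "f sums ((real x * (\<Sum>k. pmf p k * F (x + k - 1)) - f 0) + f 0)"
    by simp
  then show ?thesis
    unfolding sums_Suc_iff[symmetric] by (simp add: f_def)
qed

definition fv_rate :: "nat pmf \<Rightarrow> nat \<Rightarrow> (nat \<Rightarrow> nat) \<Rightarrow> nat \<Rightarrow> nat \<Rightarrow> real" where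
  "fv_rate p N \<xi> i y =
     gw_rate p (\<xi> i) y + gw_rate p (\<xi> i) 0 * (real N / (real N - 1)) * empirical N y \<xi>"

lemma fv_generator_eq:
  "fv_generator p N f \<xi> = (\<Sum>i=1..N. \<Sum>k. fv_rate p N \<xi> i (Suc k) * (f (\<xi>(i := Suc k)) - f \<xi>))"
  by (simp add: fv_generator_def fv_rate_def Let_def)

lemma fv_rate_nonneg: "N \<ge> 2 \<Longrightarrow> fv_rate p N \<xi> i y \<ge> 0"
  by (auto simp: fv_rate_def empirical_def intro!: add_nonneg_nonneg mult_nonneg_nonneg
        divide_nonneg_nonneg sum_nonneg gw_rate_nonneg)

lemma configs_ge1: "\<xi> \<in> configs N \<Longrightarrow> i \<in> {1..N} \<Longrightarrow> \<xi> i \<ge> 1"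
  by (auto simp: configs_def PiE_iff)

lemma countable_configs: "countable (configs N)"
  unfolding configs_def by (intro countable_PiE) auto

text \<open>
  The bracket pairs every selection jump to \<open>\<xi> j\<close> with the missing jump to 0: since \<open>F\<close> vanishes at the
  position of particle \<open>i\<close>, it equals the sum over \<open>j \<noteq> i\<close> of \<open>F (\<xi> j) - F 0\<close>.  The branching term then
  runs over the full law \<open>p\<close>, including death.
\<close>

lemma fv_rate_sums:
  fixes F :: "nat \<Rightarrow> real"
  assumes N: "N \<ge> 2" and \<xi>: "\<xi> \<in> configs N" and i: "i \<in> {1..N}" and F: "F (\<xi> i) = 0"
    and sm: "summable (\<lambda>k. pmf p k * F (\<xi> i + k - 1))"
  shows "(\<lambda>k. fv_rate p N \<xi> i (Suc k) * F (Suc k)) sums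
     (real (\<xi> i) * (\<Sum>k. pmf p k * F (\<xi> i + k - 1))
       + gw_rate p (\<xi> i) 0 / (real N - 1) * ((\<Sum>j=1..N. F (\<xi> j)) - (real N - 1) * F 0))"
proof -
  define c where "c = gw_rate p (\<xi> i) 0 / (real N - 1)"
  have "(\<lambda>k. of_bool (\<xi> j = Suc k) * F (Suc k)) sums F (\<xi> j)" if "j \<in> {1..N}" for j
  proof -
    have "\<xi> j = Suc (\<xi> j - 1)" using configs_ge1[OF \<xi> that] by simp
    then have "(\<lambda>k. of_bool (\<xi> j = Suc k) * F (Suc k)) = (\<lambda>k. if k = \<xi> j - 1 then F (\<xi> j) else 0)"
      by (auto simp: fun_eq_iff)
    then show ?thesis using sums_single[of "\<xi> j - 1" "\<lambda>_. F (\<xi> j)"] by simp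
  qed
  then have "(\<lambda>k. c * (\<Sum>j=1..N. of_bool (\<xi> j = Suc k) * F (Suc k))) sums (c * (\<Sum>j=1..N. F (\<xi> j)))"
    by (intro sums_mult sums_sum) auto
  then have "(\<lambda>k. gw_rate p (\<xi> i) (Suc k) * F (Suc k)
       + c * (\<Sum>j=1..N. of_bool (\<xi> j = Suc k) * F (Suc k))) sums
      ((real (\<xi> i) * (\<Sum>k. pmf p k * F (\<xi> i + k - 1)) - gw_rate p (\<xi> i) 0 * F 0)
       + (c * (\<Sum>j=1..N. F (\<xi> j))))"
    using \<xi> i F sm by (intro sums_add gw_rate_sums configs_ge1[of \<xi> N i])
  also have "(\<lambda>k. gw_rate p (\<xi> i) (Suc k) * F (Suc k)
       + c * (\<Sum>j=1..N. of_bool (\<xi> j = Suc k) * F (Suc k)))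
     = (\<lambda>k. fv_rate p N \<xi> i (Suc k) * F (Suc k))"
    using N by (simp add: fun_eq_iff fv_rate_def empirical_def c_def sum_distrib_right[symmetric] field_simps)
  also have "gw_rate p (\<xi> i) 0 * F 0 = c * ((real N - 1) * F 0)"
    using N by (simp add: c_def)
  finally have "(\<lambda>k. fv_rate p N \<xi> i (Suc k) * F (Suc k)) sums
     (real (\<xi> i) * (\<Sum>k. pmf p k * F (\<xi> i + k - 1)) + c * ((\<Sum>j=1..N. F (\<xi> j)) - (real N - 1) * F 0))"
    by (simp add: algebra_simps)
  then show ?thesis unfolding c_def .
qed

lemma summable_pmf: "summable (\<lambda>k. pmf (p :: nat pmf) k)"
  using pmf_abs_summable[of p UNIV]
  by (metis UNIV_I  abs_summable_on_nat_iff'  summable_norm_cancel)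

lemma summable_fv_rate:
  assumes "N \<ge> 2" "\<xi> \<in> configs N" "i \<in> {1..N}"
  shows "summable (\<lambda>k. of_bool (Suc k \<noteq> \<xi> i) * fv_rate p N \<xi> i (Suc k))"
proof -
  have "summable (\<lambda>k. pmf p k * of_bool (\<xi> i + k - 1 \<noteq> \<xi> i))"
    by (rule summable_comparison_test'[OF summable_pmf[of p], of 0]) auto
  from fv_rate_sums[of N \<xi> i "\<lambda>y. of_bool (y \<noteq> \<xi> i)", OF assms _ this]
  show ?thesis by (simp add: sums_iff mult.commute)
qed

text \<open>
  The terms with \<open>Suc k = \<xi> i\<close> leave the configuration unchanged; omitting them gives the total
  rate of genuine jumps.
\<close>

definition fv_exit :: "nat pmf \<Rightarrow> nat \<Rightarrow> (nat \<Rightarrow> nat) \<Rightarrow> real" where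
  "fv_exit p N \<xi> = (\<Sum>i=1..N. \<Sum>k. of_bool (Suc k \<noteq> \<xi> i) * fv_rate p N \<xi> i (Suc k))"

lemma fv_q_matrix_diag:
  assumes "N \<ge> 2" "\<xi> \<in> configs N"
  shows "q_matrix (fv_generator p N) \<xi> \<xi> = - fv_exit p N \<xi>"
proof -
  have "fv_rate p N \<xi> i (Suc k) * (indicator {\<xi>} (\<xi>(i := Suc k)) - indicator {\<xi>} \<xi>)
      = - (of_bool (Suc k \<noteq> \<xi> i) * fv_rate p N \<xi> i (Suc k))" for i k
    by (auto simp: indicator_def fun_upd_idem_iff)
  then show ?thesis
    using summable_fv_rate[OF assms]
    by (simp add: q_matrix_def fv_generator_eq fv_exit_def suminf_minus sum_negf)
qed

lemma fv_exit_nonneg: "N \<ge> 2 \<Longrightarrow> \<xi> \<in> configs N \<Longrightarrow> fv_exit p N \<xi> \<ge> 0"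
  unfolding fv_exit_def
  by (intro sum_nonneg suminf_nonneg summable_fv_rate mult_nonneg_nonneg fv_rate_nonneg) auto

text \<open>
  In the definition of the generator, the series is one of reals; in \<open>ennreal\<close> it can later be exchanged with the sum
  over the target \<open>z\<close>.  For given \<open>i\<close> at most one \<open>k\<close> contributes.
\<close>

lemma fv_q_matrix_offdiag:
  assumes "N \<ge> 2" "z \<noteq> \<xi>"
  shows "ennreal (q_matrix (fv_generator p N) \<xi> z)
     = (\<Sum>i=1..N. \<Sum>k. ennreal (fv_rate p N \<xi> i (Suc k)) * indicator {z} (\<xi>(i := Suc k)))"
proof -
  have one: "(\<lambda>k. fv_rate p N \<xi> i (Suc k) * indicator {z} (\<xi>(i := Suc k))) sums
     (fv_rate p N \<xi> i (z i) * of_bool (z i \<ge> 1 \<and> \<xi>(i := z i) = z))" for i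
  proof -
    have "\<xi>(i := Suc k) = z \<longleftrightarrow> k = z i - 1 \<and> z i \<ge> 1 \<and> \<xi>(i := z i) = z" for k
      by (auto simp: fun_eq_iff)
    then have "(\<lambda>k. fv_rate p N \<xi> i (Suc k) * indicator {z} (\<xi>(i := Suc k)))
      = (\<lambda>k. if k = z i - 1 then fv_rate p N \<xi> i (z i) * of_bool (z i \<ge> 1 \<and> \<xi>(i := z i) = z) else 0)"
      by (auto simp: fun_eq_iff indicator_def)
    then show ?thesis
      using sums_single[of "z i - 1" "\<lambda>_. fv_rate p N \<xi> i (z i) * of_bool (z i \<ge> 1 \<and> \<xi>(i := z i) = z)"]
      by simp
  qed
  have "(\<Sum>k. ennreal (fv_rate p N \<xi> i (Suc k)) * indicator {z} (\<xi>(i := Suc k)))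
     = ennreal (\<Sum>k. fv_rate p N \<xi> i (Suc k) * indicator {z} (\<xi>(i := Suc k)))" for i
  proof -
    have "ennreal (fv_rate p N \<xi> i (Suc k)) * indicator {z} (\<xi>(i := Suc k))
      = ennreal (fv_rate p N \<xi> i (Suc k) * indicator {z} (\<xi>(i := Suc k)))" for k
      by (simp add: indicator_def)
    moreover have "(\<Sum>k. ennreal (fv_rate p N \<xi> i (Suc k) * indicator {z} (\<xi>(i := Suc k))))
       = ennreal (\<Sum>k. fv_rate p N \<xi> i (Suc k) * indicator {z} (\<xi>(i := Suc k)))"
      using one[of i] fv_rate_nonneg[OF assms(1)]
      by (intro suminf_ennreal2 sums_summable[OF one]) auto
    ultimately show ?thesis by simp
  qed
  moreover have "0 \<le> (\<Sum>k. fv_rate p N \<xi> i (Suc k) * indicator {z} (\<xi>(i := Suc k)))" for i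
    using one[of i] fv_rate_nonneg[OF assms(1)] by (intro suminf_nonneg) (auto simp: sums_iff)
  ultimately show ?thesis
    using assms by (simp add: q_matrix_def fv_generator_eq sum_ennreal)
qed

text \<open>
  Summing over target configurations is the same as summing over the pairs of particle and new position, so
  the inflow is the exit rate times \<open>f\<close> plus the generator applied to \<open>f\<close>.  For unbounded \<open>f\<close> the series in the
  generator may diverge, and the formal generator then has no meaning; hence the summability hypothesis.
\<close>

lemma fv_inflow_le:
  fixes f :: "(nat \<Rightarrow> nat) \<Rightarrow> real"
  assumes N: "N \<ge> 2" and \<xi>: "\<xi> \<in> configs N"
    and f: "\<And>\<zeta>. f \<zeta> \<ge> 0"
    and sm: "\<And>i. i \<in> {1..N} \<Longrightarrow> summable (\<lambda>k. fv_rate p N \<xi> i (Suc k) * (f (\<xi>(i := Suc k)) - f \<xi>))"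
  shows "(\<integral>\<^sup>+z. ennreal (q_matrix (fv_generator p N) \<xi> z) * ennreal (f z) \<partial>count_space (configs N - {\<xi>}))
     \<le> ennreal (fv_exit p N \<xi> * f \<xi> + fv_generator p N f \<xi>)"
    and "0 \<le> fv_exit p N \<xi> * f \<xi> + fv_generator p N f \<xi>"
proof -
  let ?S = "configs N - {\<xi>}"
  let ?r = "\<lambda>i k. fv_rate p N \<xi> i (Suc k)"
  let ?c = "\<lambda>i k. \<xi>(i := Suc k)"
  let ?g = "\<lambda>i k. of_bool (Suc k \<noteq> \<xi> i) * (?r i k * f (?c i k))"
  have g: "?g i k = (of_bool (Suc k \<noteq> \<xi> i) * ?r i k) * f \<xi> + ?r i k * (f (?c i k) - f \<xi>)" for i k
    by (auto simp: algebra_simps fun_upd_idem)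
  have smg: "summable (?g i)" if "i \<in> {1..N}" for i
    unfolding g using that by (intro summable_add summable_mult2 summable_fv_rate N \<xi> sm)
  have gpos: "0 \<le> ?g i k" for i k using f fv_rate_nonneg[OF N] by auto
  have total: "(\<Sum>i=1..N. suminf (?g i)) = fv_exit p N \<xi> * f \<xi> + fv_generator p N f \<xi>"
  proof -
    have "suminf (?g i) = (\<Sum>k. of_bool (Suc k \<noteq> \<xi> i) * ?r i k) * f \<xi>
        + (\<Sum>k. ?r i k * (f (?c i k) - f \<xi>))" if "i \<in> {1..N}" for i
      unfolding g using summable_fv_rate[OF N \<xi> that, of p] sm[OF that]
      by (subst suminf_add[symmetric]) (auto intro: summable_mult2 simp: suminf_mult2)
    then show ?thesis
      by (simp add: fv_exit_def fv_generator_eq sum.distrib sum_distrib_right)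
  qed
  show "0 \<le> fv_exit p N \<xi> * f \<xi> + fv_generator p N f \<xi>"
    unfolding total[symmetric] by (intro sum_nonneg suminf_nonneg smg gpos) auto
  have "(\<integral>\<^sup>+z. ennreal (q_matrix (fv_generator p N) \<xi> z) * ennreal (f z) \<partial>count_space ?S)
    = (\<integral>\<^sup>+z. (\<Sum>i=1..N. \<Sum>k. ennreal (?r i k) * indicator {z} (?c i k) * ennreal (f z)) \<partial>count_space ?S)"
    by (intro nn_integral_cong)
      (auto simp: fv_q_matrix_offdiag[OF N] sum_distrib_right ennreal_suminf_multc)
  also have "\<dots> = (\<Sum>i=1..N. \<Sum>k. \<integral>\<^sup>+z. ennreal (?r i k) * indicator {z} (?c i k) * ennreal (f z) \<partial>count_space ?S)"
    by (simp add: nn_integral_sum nn_integral_suminf del: ennreal_suminf_multc)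
  also have "\<dots> \<le> (\<Sum>i=1..N. \<Sum>k. ennreal (?g i k))"
  proof (intro sum_mono suminf_le)
    fix i k
    have "(\<integral>\<^sup>+z. ennreal (?r i k) * indicator {z} (?c i k) * ennreal (f z) \<partial>count_space ?S)
       = (\<integral>\<^sup>+z. ennreal (?r i k * f (?c i k)) * indicator {?c i k} z \<partial>count_space ?S)"
      using f fv_rate_nonneg[OF N] by (intro nn_integral_cong) (auto simp: indicator_def ennreal_mult)
    also have "\<dots> = (\<integral>\<^sup>+z. ennreal (?r i k * f (?c i k)) * indicator ({?c i k} \<inter> ?S) z \<partial>count_space ?S)"
      by (intro nn_integral_cong) (auto simp: indicator_def)
    also have "\<dots> = ennreal (?r i k * f (?c i k)) * emeasure (count_space ?S) ({?c i k} \<inter> ?S)"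
      by (rule nn_integral_cmult_indicator) auto
    also have "\<dots> \<le> ennreal (?g i k)"
      by (cases "?c i k \<in> ?S") (auto simp: fun_upd_idem one_ennreal_def[symmetric])
    finally show "(\<integral>\<^sup>+z. ennreal (?r i k) * indicator {z} (?c i k) * ennreal (f z) \<partial>count_space ?S)
       \<le> ennreal (?g i k)" .
  qed auto
  also have "\<dots> = (\<Sum>i=1..N. ennreal (suminf (?g i)))"
    by (intro sum.cong refl suminf_ennreal2 gpos smg)
  also have "\<dots> = ennreal (\<Sum>i=1..N. suminf (?g i))"
    by (intro sum_ennreal suminf_nonneg gpos smg)
  finally show "(\<integral>\<^sup>+z. ennreal (q_matrix (fv_generator p N) \<xi> z) * ennreal (f z) \<partial>count_space ?S)
     \<le> ennreal (fv_exit p N \<xi> * f \<xi> + fv_generator p N f \<xi>)"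
    unfolding total .
qed

lemma fv_lyapunovI:
  assumes N: "N \<ge> 2" and v: "v \<ge> 0" and f: "\<And>\<zeta>. f \<zeta> \<ge> 0"
    and sm: "\<And>\<xi> i. \<xi> \<in> configs N \<Longrightarrow> i \<in> {1..N} \<Longrightarrow>
      summable (\<lambda>k. fv_rate p N \<xi> i (Suc k) * (f (\<xi>(i := Suc k)) - f \<xi>))"
    and drift: "\<And>\<xi>. \<xi> \<in> configs N \<Longrightarrow> fv_generator p N f \<xi> \<le> v * (K - f \<xi>)"
  shows "lyapunov (fv_generator p N) (configs N) v K f"
  unfolding lyapunov_def
proof (intro ballI conjI f)
  fix \<xi> assume \<xi>: "\<xi> \<in> configs N"
  let ?q = "q_matrix (fv_generator p N) \<xi>"
  have q: "?q \<xi> = - fv_exit p N \<xi>" by (rule fv_q_matrix_diag[OF N \<xi>])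
  show "?q \<xi> \<le> 0" using fv_exit_nonneg[OF N \<xi>, of p] by (simp add: q)
  have "(\<integral>\<^sup>+z. ennreal (?q z) * ennreal (f z) \<partial>count_space (configs N - {\<xi>})) + ennreal (v * f \<xi>)
      \<le> ennreal (fv_exit p N \<xi> * f \<xi> + fv_generator p N f \<xi>) + ennreal (v * f \<xi>)"
    using sm[OF \<xi>] by (intro add_right_mono fv_inflow_le N \<xi> f)
  also have "\<dots> = ennreal (fv_exit p N \<xi> * f \<xi> + fv_generator p N f \<xi> + v * f \<xi>)"
    using fv_inflow_le(2)[OF N \<xi> f sm[OF \<xi>]] v f by (intro ennreal_plus[symmetric]) auto
  also have "\<dots> \<le> ennreal (- ?q \<xi> * f \<xi> + v * K)"
    using drift[OF \<xi>] by (intro ennreal_leI) (simp add: q right_diff_distrib)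
  finally show "(\<integral>\<^sup>+z. ennreal (?q z) * ennreal (f z) \<partial>count_space (configs N - {\<xi>})) + ennreal (v * f \<xi>)
      \<le> ennreal (- ?q \<xi> * f \<xi> + v * K)" .
qed

section \<open>Drift of \<open>\<psi>\<close>\<close>

lemma summable_second_moment:
  assumes "exp_moment p"
  shows "summable (\<lambda>k. pmf p k * (real k)\<^sup>2)"
proof -
  obtain \<sigma> where \<sigma>: "\<sigma> > 0" and sm: "summable (\<lambda>k. pmf p k * exp (\<sigma> * real k))"
    using assms by (auto simp: exp_moment_def)
  show ?thesis
  proof (rule summable_comparison_test'[where N=0])
    show "summable (\<lambda>k. 2 / \<sigma>\<^sup>2 * (pmf p k * exp (\<sigma> * real k)))" by (intro summable_mult sm)
    fix k :: nat
    have "(\<sigma> * real k)\<^sup>2 / 2 \<le> exp (\<sigma> * real k)"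
      using exp_lower_Taylor_quadratic[of "\<sigma> * real k"] \<sigma> by (smt (verit) mult_nonneg_nonneg of_nat_0_le_iff)
    then have "(real k)\<^sup>2 \<le> 2 / \<sigma>\<^sup>2 * exp (\<sigma> * real k)"
      using \<sigma> by (simp add: field_simps power_mult_distrib)
    then have "pmf p k * (real k)\<^sup>2 \<le> pmf p k * (2 / \<sigma>\<^sup>2 * exp (\<sigma> * real k))"
      by (intro mult_left_mono) auto
    then show "norm (pmf p k * (real k)\<^sup>2) \<le> 2 / \<sigma>\<^sup>2 * (pmf p k * exp (\<sigma> * real k))"
      by (simp add: mult_ac)
  qed
qed

lemma summable_first_moment:
  assumes "exp_moment p"
  shows "summable (\<lambda>k. pmf p k * real k)"
proof (rule summable_comparison_test'[OF summable_second_moment[OF assms], where N=0])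
  fix k :: nat
  have "real k \<le> (real k)\<^sup>2" by (cases k) (auto simp: power2_eq_square)
  then show "norm (pmf p k * real k) \<le> pmf p k * (real k)\<^sup>2"
    by (simp add: mult_left_mono)
qed

lemma summable_second_centred_moment:
  assumes exp: "exp_moment p"
  shows "summable (\<lambda>k. (real k - 1)\<^sup>2 * pmf p k)"
  using summable_add[OF summable_diff[OF summable_second_moment[OF exp]
          summable_mult[OF summable_first_moment[OF exp], of 2]] summable_pmf[of p]]
  by (simp add: algebra_simps power2_eq_square)

lemma psi_nonneg: "psi N \<xi> \<ge> 0"
  by (auto simp: psi_def intro!: divide_nonneg_nonneg sum_nonneg)

lemma psi_le_sum: "psi N \<xi> \<le> (\<Sum>i=1..N. real (\<xi> i))"
proof -
  have "(\<Sum>i=1..N. (real (\<xi> i))\<^sup>2) \<le> (\<Sum>i=1..N. real (\<xi> i) * (\<Sum>i=1..N. real (\<xi> i)))"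
    unfolding power2_eq_square
    by (intro sum_mono mult_left_mono member_le_sum) auto
  then have "(\<Sum>i=1..N. (real (\<xi> i))\<^sup>2) \<le> (\<Sum>i=1..N. real (\<xi> i)) * (\<Sum>i=1..N. real (\<xi> i))"
    by (simp add: sum_distrib_right)
  moreover have "0 \<le> (\<Sum>i=1..N. real (\<xi> i))" by (intro sum_nonneg) auto
  ultimately show ?thesis
    unfolding psi_def by (metis div_by_0 pos_divide_le_eq order_le_less)
qed

lemma configs_sum_ge:
  assumes "\<xi> \<in> configs N"
  shows "real N \<le> (\<Sum>i=1..N. real (\<xi> i))"
proof -
  have "(\<Sum>i=1..N. 1) \<le> (\<Sum>i=1..N. real (\<xi> i))"
    using configs_ge1[OF assms] by (intro sum_mono) auto
  then show ?thesis by simp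
qed

lemma psi_mult_sum:
  assumes "\<xi> \<in> configs N" "N \<ge> 2"
  shows "psi N \<xi> * (\<Sum>i=1..N. real (\<xi> i)) = (\<Sum>i=1..N. (real (\<xi> i))\<^sup>2)"
  using configs_sum_ge[OF assms(1)] assms(2) by (simp add: psi_def)

lemma psi_ge1:
  assumes "\<xi> \<in> configs N" "N \<ge> 2"
  shows "psi N \<xi> \<ge> 1"
proof -
  have "(\<Sum>i=1..N. real (\<xi> i)) \<le> (\<Sum>i=1..N. (real (\<xi> i))\<^sup>2)"
    using configs_ge1[OF assms(1)] by (intro sum_mono self_le_power) auto
  then show ?thesis
    using configs_sum_ge[OF assms(1)] assms(2) by (simp add: psi_def)
qed

lemma sum_fun_upd:
  fixes h :: "nat \<Rightarrow> real" and \<xi> :: "nat \<Rightarrow> nat"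
  assumes "i \<in> {1..N}"
  shows "(\<Sum>j=1..N. h ((\<xi>(i := y)) j)) = (\<Sum>j=1..N. h (\<xi> j)) + (h y - h (\<xi> i))"
proof -
  have "(\<Sum>j=1..N. h ((\<xi>(i := y)) j)) = h y + (\<Sum>j\<in>{1..N} - {i}. h (\<xi> j))"
    using assms by (subst sum.remove[of _ i]) (auto intro!: sum.cong)
  moreover have "(\<Sum>j=1..N. h (\<xi> j)) = h (\<xi> i) + (\<Sum>j\<in>{1..N} - {i}. h (\<xi> j))"
    using assms by (subst sum.remove[of _ i]) auto
  ultimately show ?thesis by simp
qed

lemma psi_fun_upd_diff:
  fixes S :: real
  assumes \<xi>: "\<xi> \<in> configs N" and N: "N \<ge> 2" and i: "i \<in> {1..N}"
    and S: "S = (\<Sum>j=1..N. real (\<xi> j))" and pos: "S + (real y - real (\<xi> i)) > 0"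
  shows "psi N (\<xi>(i := y)) - psi N \<xi> =
    ((real y)\<^sup>2 - (real (\<xi> i))\<^sup>2 - psi N \<xi> * (real y - real (\<xi> i))) / (S + (real y - real (\<xi> i)))"
proof -
  have "psi N (\<xi>(i := y)) = (psi N \<xi> * S + ((real y)\<^sup>2 - (real (\<xi> i))\<^sup>2)) / (S + (real y - real (\<xi> i)))"
    unfolding psi_def[of N "\<xi>(i := y)"] S psi_mult_sum[OF \<xi> N]
    using sum_fun_upd[OF i, of real \<xi> y] sum_fun_upd[OF i, of "\<lambda>y. (real y)\<^sup>2" \<xi> y] by simp
  then show ?thesis using pos by (simp add: field_simps)
qed

text \<open>
  The left-hand side is the exact change of \<open>c = \<psi>\<close> when a particle at \<open>x\<close> moves by \<open>l\<close>.  Linearising the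
  denominator costs \<open>l\<^sup>2 (c - 2 x - l) / (S (S + l))\<close>, and \<open>c \<le> S\<close> reduces this to at most \<open>2 l\<^sup>2 / S\<close>.
\<close>

lemma branching_increment_le:
  fixes x l S c :: real
  assumes "x \<ge> 1" "S \<ge> 2" "c \<le> S" "l \<ge> -1"
  shows "(2 * l * x + l\<^sup>2 - c * l) / (S + l) \<le> (2 * l * x + 3 * l\<^sup>2 - c * l) / S"
proof -
  have "0 \<le> l\<^sup>2 * (2 * S + 2 * x + 3 * l - c)"
    using assms by (intro mult_nonneg_nonneg) auto
  also have "\<dots> = (2 * l * x + 3 * l\<^sup>2 - c * l) * (S + l) - (2 * l * x + l\<^sup>2 - c * l) * S"
    by (simp add: algebra_simps power2_eq_square)
  finally show ?thesis using assms by (simp add: divide_simps)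
qed

text \<open>
  The left-hand side is the exact change of \<open>c = \<psi>\<close> when a particle at 1 jumps to \<open>y\<close>.  It differs from
  its linearisation by \<open>- (y - 1)\<^sup>2 (y + 1 - c) / (S (S + y - 1))\<close>, where
  \<open>(y - 1)\<^sup>2 / (S + y - 1) = y h(y)\<close> with \<open>h\<close> increasing.  Hence \<open>h(y) (y - c) \<ge> h(c) (y - c)\<close> for
  every \<open>y\<close>, as in the proof of Chebyshev's sum inequality.  The resulting correction
  \<open>h(c) (y\<^sup>2 - c y)\<close> may have either sign for a single \<open>y\<close>, but it sums to 0 over all particles because \<open>\<psi>\<close> is the mean
  of the positions with weights proportional to \<open>\<xi> j\<close>.
\<close>

lemma selection_increment_le:
  fixes y S c :: real
  assumes y: "y \<ge> 1" and c: "c \<ge> 1" and S: "S > 0"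
  defines "h \<equiv> \<lambda>y. (y - 1) / y * ((y - 1) / (S + y - 1))"
  shows "(y\<^sup>2 - 1 - c * (y - 1)) / (S + y - 1) \<le> ((y\<^sup>2 - 1 - c * (y - 1)) - h c * (y\<^sup>2 - c * y)) / S"
proof -
  have mono: "h s \<le> h t" if "1 \<le> s" "s \<le> t" for s t
  proof -
    have "(s - 1) / s \<le> (t - 1) / t" using that by (simp add: field_simps)
    moreover have "(s - 1) / (S + s - 1) \<le> (t - 1) / (S + t - 1)"
      using that S by (simp add: field_simps) 
    ultimately show ?thesis
      unfolding h_def using that S by (intro mult_mono) auto
  qed
  have "h c * (y - c) \<le> h y * (y - c)"
    using mono[of c y] mono[of y c] y c by (cases "c \<le> y") (auto intro: mult_right_mono mult_right_mono_neg)
  then have "y * (h c * (y - c)) \<le> y * (h y * (y - c))"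
    using y by (intro mult_left_mono) auto
  also have "\<dots> = (y - 1)\<^sup>2 / (S + y - 1) * (y - c)"
    using y by (simp add: h_def power2_eq_square)
  also have "\<dots> \<le> (y - 1)\<^sup>2 / (S + y - 1) * (y + 1 - c)"
    using y S by (intro mult_left_mono) auto
  finally have "h c * (y\<^sup>2 - c * y) \<le> (y - 1)\<^sup>2 / (S + y - 1) * (y + 1 - c)"
    by (simp add: algebra_simps power2_eq_square)
  moreover have "(y - 1)\<^sup>2 / (S + y - 1) * (y + 1 - c)
     = (y\<^sup>2 - 1 - c * (y - 1)) - S * ((y\<^sup>2 - 1 - c * (y - 1)) / (S + y - 1))"
  proof -
    have "S + y - 1 > 0" using y S by simp
    then show ?thesis by (simp add: divide_simps) (simp add: algebra_simps power2_eq_square)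
  qed
  ultimately show ?thesis using S by (simp add: field_simps)
qed

text \<open>
  The selection jumps sum up to at most \<open>N (\<psi> - 1) / S\<close>.  By itself this can be of the order of \<open>\<psi>\<close>, and it
  is the compensation by the deaths, \<open>(N - 1) (\<psi> - 1) / (S - 1)\<close>, that brings it down to a constant.
\<close>

lemma selection_drift_le:
  assumes \<xi>: "\<xi> \<in> configs N" and N: "N \<ge> 2" and i: "i \<in> {1..N}" and one: "\<xi> i = 1"
  defines "W \<equiv> \<lambda>y. psi N (\<xi>(i := y)) - psi N \<xi>"
  shows "(\<Sum>j=1..N. W (\<xi> j)) - (real N - 1) * W 0 \<le> 1"
proof -
  define S where "S = (\<Sum>j=1..N. real (\<xi> j))"
  define c where "c = psi N \<xi>"
  have S: "S \<ge> real N" using configs_sum_ge[OF \<xi>] by (simp add: S_def)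
  have c: "c \<ge> 1" "c \<le> S" using psi_ge1[OF \<xi> N] psi_le_sum[of N \<xi>] by (auto simp: c_def S_def)
  have cS: "(\<Sum>j=1..N. (real (\<xi> j))\<^sup>2) = c * S" using psi_mult_sum[OF \<xi> N] by (simp add: c_def S_def)
  have W: "W y = ((real y)\<^sup>2 - 1 - c * (real y - 1)) / (S + real y - 1)" for y
    unfolding W_def using psi_fun_upd_diff[OF \<xi> N i S_def, of y] S N one
    by (simp add: c_def add_diff_eq)
  define h where "h = (c - 1) / c * ((c - 1) / (S + c - 1))"
  have "(\<Sum>j=1..N. W (\<xi> j)) \<le> (\<Sum>j=1..N. (((real (\<xi> j))\<^sup>2 - 1 - c * (real (\<xi> j) - 1))
      - h * ((real (\<xi> j))\<^sup>2 - c * real (\<xi> j))) / S)"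
    unfolding W h_def using configs_ge1[OF \<xi>] c S N
    by (intro sum_mono selection_increment_le) auto
  also have "\<dots> = ((c * S - real N - c * (S - real N)) - h * (c * S - c * S)) / S"
    by (simp add: sum_divide_distrib[symmetric] sum_subtractf sum_distrib_left[symmetric]
        cS[unfolded One_nat_def] S_def[unfolded One_nat_def, symmetric])
  also have "\<dots> = real N * (c - 1) / S" by (simp add: algebra_simps)
  finally have "(\<Sum>j=1..N. W (\<xi> j)) - (real N - 1) * W 0
      \<le> real N * (c - 1) / S - (real N - 1) * ((c - 1) / (S - 1))"
    by (simp add: W)
  also have "\<dots> = (c - 1) / (S - 1) * ((S - real N) / S)"
    using S N by (simp add: divide_simps) (simp add: algebra_simps)
  also have "\<dots> \<le> 1 * 1"
    using S N c by (intro mult_mono) auto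
  finally show ?thesis by simp
qed

text \<open>
  Summing the linearised branching terms weighted with the rate \<open>\<xi> i\<close> gives
  \<open>(- 2 v Q + 3 b S + \<psi> v S) / S = - v \<psi> + 3 b\<close>.  Each of the at most \<open>N\<close> particles at 1 adds at most
  \<open>1 / (N - 1)\<close> through selection, in total \<open>N / (N - 1) \<le> 2\<close>.
\<close>

lemma fv_generator_psi_le:
  fixes v b :: real
  assumes exp: "exp_moment p" and N: "N \<ge> 2" and \<xi>: "\<xi> \<in> configs N"
    and v: "v = - (\<Sum>k. (real k - 1) * pmf p k)" and b: "b = (\<Sum>k. (real k - 1)\<^sup>2 * pmf p k)"
  shows "fv_generator p N (psi N) \<xi> \<le> - v * psi N \<xi> + (3 * b + 2)"
    and "\<And>i. i \<in> {1..N} \<Longrightarrow> summable (\<lambda>k. fv_rate p N \<xi> i (Suc k) * (psi N (\<xi>(i := Suc k)) - psi N \<xi>))"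
proof -
  define S where "S = (\<Sum>j=1..N. real (\<xi> j))"
  define c where "c = psi N \<xi>"
  define W where "W i y = psi N (\<xi>(i := y)) - psi N \<xi>" for i y
  have S: "S \<ge> real N" using configs_sum_ge[OF \<xi>] by (simp add: S_def)
  have c: "c \<ge> 1" "c \<le> S" using psi_ge1[OF \<xi> N] psi_le_sum[of N \<xi>] by (auto simp: c_def S_def)
  have cS: "(\<Sum>j=1..N. (real (\<xi> j))\<^sup>2) = c * S" using psi_mult_sum[OF \<xi> N] by (simp add: c_def S_def)
  have sm_l: "summable (\<lambda>k. (real k - 1) * pmf p k)"
    using summable_diff[OF summable_first_moment[OF exp] summable_pmf[of p]] by (simp add: algebra_simps)
  have sm_l2: "summable (\<lambda>k. (real k - 1)\<^sup>2 * pmf p k)"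
    by (rule summable_second_centred_moment[OF exp])
  have smW: "summable (\<lambda>k. pmf p k * W i (\<xi> i + k - 1))" if i: "i \<in> {1..N}" for i
  proof (rule summable_comparison_test'[where N=0])
    show "summable (\<lambda>k. (2 * S + real (\<xi> i)) * pmf p k + pmf p k * real k)"
      by (intro summable_add summable_mult summable_pmf summable_first_moment exp)
    fix k
    have "\<bar>W i y\<bar> \<le> 2 * S + real y" for y
    proof -
      have "psi N (\<xi>(i := y)) \<le> S + (real y - real (\<xi> i))"
        using psi_le_sum[of N "\<xi>(i := y)"] sum_fun_upd[OF i, of real \<xi> y] by (simp add: S_def)
      then show ?thesis
        using psi_nonneg[of N "\<xi>(i := y)"] psi_nonneg[of N \<xi>] psi_le_sum[of N \<xi>]
        unfolding W_def S_def[symmetric] by linarith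
    qed
    from this[of "\<xi> i + k - 1"] have "\<bar>W i (\<xi> i + k - 1)\<bar> \<le> 2 * S + real (\<xi> i) + real k"
      by linarith
    then have "pmf p k * \<bar>W i (\<xi> i + k - 1)\<bar> \<le> pmf p k * (2 * S + real (\<xi> i) + real k)"
      by (intro mult_left_mono) auto
    then show "norm (pmf p k * W i (\<xi> i + k - 1)) \<le> (2 * S + real (\<xi> i)) * pmf p k + pmf p k * real k"
      by (simp add: abs_mult algebra_simps)
  qed
  have sums: "(\<lambda>k. fv_rate p N \<xi> i (Suc k) * W i (Suc k)) sums
     (real (\<xi> i) * (\<Sum>k. pmf p k * W i (\<xi> i + k - 1))
       + gw_rate p (\<xi> i) 0 / (real N - 1) * ((\<Sum>j=1..N. W i (\<xi> j)) - (real N - 1) * W i 0))"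
    if "i \<in> {1..N}" for i
    using N \<xi> that by (intro fv_rate_sums smW) (auto simp: W_def)
  show "summable (\<lambda>k. fv_rate p N \<xi> i (Suc k) * (psi N (\<xi>(i := Suc k)) - psi N \<xi>))"
    if "i \<in> {1..N}" for i
    using sums[OF that] by (simp add: W_def sums_iff)
  have each: "(\<Sum>k. fv_rate p N \<xi> i (Suc k) * W i (Suc k))
      \<le> (- 2 * v * (real (\<xi> i))\<^sup>2 + (3 * b + c * v) * real (\<xi> i)) / S + 1 / (real N - 1)"
    if i: "i \<in> {1..N}" for i
  proof -
    have x: "\<xi> i \<ge> 1" using configs_ge1[OF \<xi> i] .
    have term_le: "pmf p k * W i (\<xi> i + k - 1)
       \<le> ((2 * real (\<xi> i) - c) * ((real k - 1) * pmf p k) + 3 * ((real k - 1)\<^sup>2 * pmf p k)) / S" for k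
    proof -
      define l where "l = real k - 1"
      have y: "real (\<xi> i + k - 1) = real (\<xi> i) + l" using x by (simp add: l_def)
      have "W i (\<xi> i + k - 1) = (2 * l * real (\<xi> i) + l\<^sup>2 - c * l) / (S + l)"
        unfolding W_def using psi_fun_upd_diff[OF \<xi> N i S_def, of "\<xi> i + k - 1"] S N
        unfolding y by (simp add: c_def l_def power2_eq_square algebra_simps)
      also have "\<dots> \<le> (2 * l * real (\<xi> i) + 3 * l\<^sup>2 - c * l) / S"
        using x S N c by (intro branching_increment_le) (auto simp: l_def)
      finally have "pmf p k * W i (\<xi> i + k - 1) \<le> pmf p k * ((2 * l * real (\<xi> i) + 3 * l\<^sup>2 - c * l) / S)"
        by (intro mult_left_mono) auto
      then show ?thesis by (simp add: l_def[symmetric] algebra_simps)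
    qed
    have "(\<lambda>k. ((2 * real (\<xi> i) - c) * ((real k - 1) * pmf p k) + 3 * ((real k - 1)\<^sup>2 * pmf p k)) / S)
       sums (((2 * real (\<xi> i) - c) * (- v) + 3 * b) / S)"
      unfolding v b minus_minus by (intro sums_divide sums_add sums_mult summable_sums sm_l sm_l2)
    then have "(\<Sum>k. pmf p k * W i (\<xi> i + k - 1)) \<le> ((2 * real (\<xi> i) - c) * (- v) + 3 * b) / S"
      using smW[OF i] term_le by (meson sums_le summable_sums)
    then have "real (\<xi> i) * (\<Sum>k. pmf p k * W i (\<xi> i + k - 1))
        \<le> real (\<xi> i) * (((2 * real (\<xi> i) - c) * (- v) + 3 * b) / S)"
      by (intro mult_left_mono) auto
    also have "\<dots> = (- 2 * v * (real (\<xi> i))\<^sup>2 + (3 * b + c * v) * real (\<xi> i)) / S"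
      by (simp add: algebra_simps power2_eq_square)
    finally have branching: "real (\<xi> i) * (\<Sum>k. pmf p k * W i (\<xi> i + k - 1)) \<le> \<dots>" .
    have "gw_rate p (\<xi> i) 0 / (real N - 1) * ((\<Sum>j=1..N. W i (\<xi> j)) - (real N - 1) * W i 0)
       \<le> 1 / (real N - 1)"
    proof (cases "\<xi> i = 1")
      case True
      have "gw_rate p (\<xi> i) 0 / (real N - 1) * ((\<Sum>j=1..N. W i (\<xi> j)) - (real N - 1) * W i 0)
        \<le> gw_rate p (\<xi> i) 0 / (real N - 1) * 1"
        using N selection_drift_le[OF \<xi> N i True] gw_rate_nonneg[of p "\<xi> i" 0]
        unfolding W_def by (intro mult_left_mono) auto
      also have "\<dots> \<le> 1 / (real N - 1)"
        using True N pmf_le_1[of p 0] by (simp add: gw_rate_def divide_right_mono)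
      finally show ?thesis .
    next
      case False
      then have "gw_rate p (\<xi> i) 0 = 0" by (auto simp: gw_rate_def)
      then show ?thesis using N by simp
    qed
    then show ?thesis using branching sums[OF i] by (simp add: sums_iff)
  qed
  have "fv_generator p N (psi N) \<xi> = (\<Sum>i=1..N. \<Sum>k. fv_rate p N \<xi> i (Suc k) * W i (Suc k))"
    by (simp add: fv_generator_eq W_def)
  also have "\<dots> \<le> (\<Sum>i=1..N. (- 2 * v * (real (\<xi> i))\<^sup>2 + (3 * b + c * v) * real (\<xi> i)) / S + 1 / (real N - 1))"
    by (intro sum_mono each) auto
  also have "\<dots> = (- 2 * v * (c * S) + (3 * b + c * v) * S) / S + real N / (real N - 1)"
    by (simp add: sum.distrib sum_subtractf sum_divide_distrib[symmetric] sum_distrib_left[symmetric]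
        cS[unfolded One_nat_def] S_def[unfolded One_nat_def, symmetric])
  also have "\<dots> = - v * c + 3 * b + real N / (real N - 1)"
    using S N by (simp add: field_simps)
  also have "\<dots> \<le> - v * c + 3 * b + 2"
    using N by (simp add: field_simps)
  finally show "fv_generator p N (psi N) \<xi> \<le> - v * psi N \<xi> + (3 * b + 2)"
    by (simp add: c_def)
qed

section \<open>The uniform bound\<close>

theorem corollary1p4:
  fixes p :: "nat pmf"
  assumes "exp_moment p" and "subcritical p"
  shows "\<exists>C>0::real. \<forall>N\<ge>2. \<forall>\<mu>. fv_invariant p N \<mu> \<longrightarrow>
           (\<integral>\<^sup>+\<xi>. ennreal (psi N \<xi>) \<partial>measure_pmf \<mu>) \<le> ennreal C"
proof -
  define v where "v = - (\<Sum>k. (real k - 1) * pmf p k)"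
  define b where "b = (\<Sum>k. (real k - 1)\<^sup>2 * pmf p k)"
  define C where "C = (3 * b + 2) / v"
  have v: "v > 0" using assms(2) by (simp add: v_def subcritical_def)
  have "0 \<le> b"
    unfolding b_def by (intro suminf_nonneg summable_second_centred_moment assms(1)) auto
  then have C: "C > 0" using v by (simp add: C_def)
  have "(\<integral>\<^sup>+\<xi>. ennreal (psi N \<xi>) \<partial>measure_pmf \<mu>) \<le> ennreal C"
    if N: "N \<ge> 2" and inv: "fv_invariant p N \<mu>" for N \<mu>
  proof (rule invariant_distribution_lyapunov)
    show "lyapunov (fv_generator p N) (configs N) v C (psi N)"
    proof (rule fv_lyapunovI[OF N])
      fix \<xi> assume \<xi>: "\<xi> \<in> configs N"
      show "fv_generator p N (psi N) \<xi> \<le> v * (C - psi N \<xi>)"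
        using fv_generator_psi_le(1)[OF assms(1) N \<xi> v_def b_def] v
        by (simp add: C_def right_diff_distrib)
    qed (use fv_generator_psi_le(2)[OF assms(1) N _ v_def b_def] v psi_nonneg in auto)
    show "lyapunov (fv_generator p N) (configs N) v 1 (\<lambda>_. 1)"
      using v by (intro fv_lyapunovI[OF N]) (auto simp: fv_generator_eq)
    show "invariant_distribution (fv_generator p N) (configs N) \<mu>"
      using inv by (simp add: fv_invariant_def)
  qed (use v C countable_configs in auto)
  then show ?thesis using C by blast
qed

end
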